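(* Let $\mathcal{S}4$ (Hintikka's epistemic logic) be the modal logic with knowledge operator $K_i$ given by: all propositional tautologies; Distribution $K_i(\varphi\to\psi)\to(K_i\varphi\to K_i\psi)$; Truth $K_i\varphi\to\varphi$; Positive Introspection $K_i\varphi\to K_iK_i\varphi$; modus ponens; and necessitation (from $\vdash\varphi$ infer $\vdash K_i\varphi$). Assume the language expresses Löb sentences for $K_i$, i.e., for every formula $\varphi$ there is a formula $\psi$ such that $\vdash K_i(\psi\leftrightarrow(K_i\psi\to\varphi))$. Then this logic crashes.
   Context: Write $\Diamond$ for the dual $\neg\Box\neg$. "Löb's Theorem for $K_i$" is the scheme $K_i(K_i\varphi\to\varphi)\to K_i\varphi$ for all $\varphi$. The logic is interpreted on frames whose accessibility relation for $K_i$ is reflexive (corresponding to the Truth axiom) and transitive (corresponding to Positive Introspection). Definition: a modal logic with operators $\Box_i$ defined by relations $\mathcal{R}_i$ crashes if and only if its axioms derive Löb's Theorem for at least one $\Box_i$ and $\mathcal{R}_i$ is serial or reflexive. *)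

theory Defs
  imports Main
begin

section \<open>Epistemic formulas\<close>

datatype ('i, 'p) fm =
    Atom 'p
  | Falsum ("\<^bold>\<bottom>")
  | Neg "('i, 'p) fm" ("\<^bold>\<not> _" [70] 70)
  | Conj "('i, 'p) fm" "('i, 'p) fm" (infixr "\<^bold>\<and>" 65)
  | Disj "('i, 'p) fm" "('i, 'p) fm" (infixr "\<^bold>\<or>" 60)
  | Imp "('i, 'p) fm" "('i, 'p) fm" (infixr "\<^bold>\<rightarrow>" 55)
  | Iff "('i, 'p) fm" "('i, 'p) fm" (infixr "\<^bold>\<leftrightarrow>" 50)
  | K 'i "('i, 'p) fm"

text \<open>Propositional evaluation: formulas with outermost operator \<open>K i\<close> are treated as
  further propositional atoms, whose truth values are given by \<open>h\<close>.\<close>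

primrec prop_eval :: "('p \<Rightarrow> bool) \<Rightarrow> ('i \<Rightarrow> ('i, 'p) fm \<Rightarrow> bool) \<Rightarrow> ('i, 'p) fm \<Rightarrow> bool" where
  "prop_eval g h (Atom p) = g p"
| "prop_eval g h \<^bold>\<bottom> = False"
| "prop_eval g h (\<^bold>\<not> \<phi>) = (\<not> prop_eval g h \<phi>)"
| "prop_eval g h (\<phi> \<^bold>\<and> \<psi>) = (prop_eval g h \<phi> \<and> prop_eval g h \<psi>)"
| "prop_eval g h (\<phi> \<^bold>\<or> \<psi>) = (prop_eval g h \<phi> \<or> prop_eval g h \<psi>)"
| "prop_eval g h (\<phi> \<^bold>\<rightarrow> \<psi>) = (prop_eval g h \<phi> \<longrightarrow> prop_eval g h \<psi>)"
| "prop_eval g h (\<phi> \<^bold>\<leftrightarrow> \<psi>) = (prop_eval g h \<phi> \<longleftrightarrow> prop_eval g h \<psi>)"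
| "prop_eval g h (K i \<phi>) = h i \<phi>"

definition tautology :: "('i, 'p) fm \<Rightarrow> bool" where
  "tautology \<phi> \<longleftrightarrow> (\<forall>g h. prop_eval g h \<phi>)"

section \<open>Frames\<close>

record ('i, 'w) frame =
  worlds :: "'w set"
  acc :: "'i \<Rightarrow> ('w \<times> 'w) set"

definition is_frame :: "('i, 'w) frame \<Rightarrow> bool" where
  "is_frame F \<longleftrightarrow> worlds F \<noteq> {} \<and> (\<forall>i. acc F i \<subseteq> worlds F \<times> worlds F)"

definition serial_on :: "'w set \<Rightarrow> ('w \<times> 'w) set \<Rightarrow> bool" where
  "serial_on W r \<longleftrightarrow> (\<forall>w\<in>W. \<exists>v\<in>W. (w, v) \<in> r)"

primrec sat :: "('i, 'w) frame \<Rightarrow> ('w \<Rightarrow> 'p \<Rightarrow> bool) \<Rightarrow> 'w \<Rightarrow> ('i, 'p) fm \<Rightarrow> bool" where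
  "sat F V w (Atom p) = V w p"
| "sat F V w \<^bold>\<bottom> = False"
| "sat F V w (\<^bold>\<not> \<phi>) = (\<not> sat F V w \<phi>)"
| "sat F V w (\<phi> \<^bold>\<and> \<psi>) = (sat F V w \<phi> \<and> sat F V w \<psi>)"
| "sat F V w (\<phi> \<^bold>\<or> \<psi>) = (sat F V w \<phi> \<or> sat F V w \<psi>)"
| "sat F V w (\<phi> \<^bold>\<rightarrow> \<psi>) = (sat F V w \<phi> \<longrightarrow> sat F V w \<psi>)"
| "sat F V w (\<phi> \<^bold>\<leftrightarrow> \<psi>) = (sat F V w \<phi> \<longleftrightarrow> sat F V w \<psi>)"
| "sat F V w (K i \<phi>) = (\<forall>v\<in>worlds F. (w, v) \<in> acc F i \<longrightarrow> sat F V v \<phi>)"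

definition valid_on :: "('i, 'w) frame \<Rightarrow> ('i, 'p) fm \<Rightarrow> bool" where
  "valid_on F \<phi> \<longleftrightarrow> (\<forall>V. \<forall>w\<in>worlds F. sat F V w \<phi>)"

section \<open>Modal logics\<close>

inductive derives :: "('i, 'p) fm set \<Rightarrow> ('i, 'p) fm \<Rightarrow> bool" (infix "\<turnstile>" 40)
  for A :: "('i, 'p) fm set" where
  axiom: "\<phi> \<in> A \<Longrightarrow> A \<turnstile> \<phi>"
| modus_ponens: "A \<turnstile> \<phi> \<^bold>\<rightarrow> \<psi> \<Longrightarrow> A \<turnstile> \<phi> \<Longrightarrow> A \<turnstile> \<psi>"
| necessitation: "A \<turnstile> \<phi> \<Longrightarrow> A \<turnstile> K i \<phi>"

text \<open>A modal logic is given by its axioms and by the class of frames whose relations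
  \<^term>\<open>acc F i\<close> interpret the operators \<^term>\<open>K i\<close> (as in \<^const>\<open>sat\<close>).\<close>

record ('i, 'p, 'w) modal_logic =
  axioms :: "('i, 'p) fm set"
  frames :: "('i, 'w) frame set"

definition derives_loeb :: "('i, 'p) fm set \<Rightarrow> 'i \<Rightarrow> bool" where
  "derives_loeb A i \<longleftrightarrow> (\<forall>\<phi>. A \<turnstile> K i (K i \<phi> \<^bold>\<rightarrow> \<phi>) \<^bold>\<rightarrow> K i \<phi>)"

definition crashes :: "('i, 'p, 'w) modal_logic \<Rightarrow> bool" where
  "crashes L \<longleftrightarrow>
     (\<exists>i. derives_loeb (axioms L) i \<and>
          ((\<forall>F\<in>frames L. serial_on (worlds F) (acc F i)) \<or>
           (\<forall>F\<in>frames L. refl_on (worlds F) (acc F i))))"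

definition expresses_loeb_sentences :: "('i, 'p) fm set \<Rightarrow> 'i \<Rightarrow> bool" where
  "expresses_loeb_sentences A i \<longleftrightarrow>
     (\<forall>\<phi>. \<exists>\<psi>. A \<turnstile> K i (\<psi> \<^bold>\<leftrightarrow> (K i \<psi> \<^bold>\<rightarrow> \<phi>)))"

section \<open>Hintikka's epistemic logic\<close>

definition S4_axioms :: "('i, 'p) fm set" where
  "S4_axioms =
     {\<phi>. tautology \<phi>}
   \<union> {K i (\<phi> \<^bold>\<rightarrow> \<psi>) \<^bold>\<rightarrow> (K i \<phi> \<^bold>\<rightarrow> K i \<psi>) | i \<phi> \<psi>. True}
   \<union> {K i \<phi> \<^bold>\<rightarrow> \<phi> | i \<phi>. True}
   \<union> {K i \<phi> \<^bold>\<rightarrow> K i (K i \<phi>) | i \<phi>. True}"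

definition S4_frames :: "('i, 'w) frame set" where
  "S4_frames = {F. is_frame F \<and> (\<forall>i. refl_on (worlds F) (acc F i) \<and> trans (acc F i))}"

text \<open>The parameter \<open>T\<close> is what the language can prove beyond the epistemic axioms, for instance
  the instances of a diagonal lemma for an interpreted arithmetic; pure S4 is the case
  \<open>T = {}\<close>. It is needed because pure S4 proves no Loeb sentence for
  \<^term>\<open>\<^bold>\<bottom>\<close> (lemma \<open>pure_S4_no_loeb_sentences\<close> below), so that any language expressing
  all Loeb sentences owes this to such a \<open>T\<close>.\<close>

definition S4 :: "('i, 'p) fm set \<Rightarrow> ('i, 'p, 'w) modal_logic" where
  "S4 T = \<lparr>axioms = S4_axioms \<union> T, frames = S4_frames\<rparr>"

lemma sat_tautology:
  assumes "tautology \<phi>"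
  shows "sat F V w \<phi>"
proof -
  have "sat F V w \<psi> \<longleftrightarrow> prop_eval (V w) (\<lambda>i \<chi>. sat F V w (K i \<chi>)) \<psi>" for \<psi>
    by (induction \<psi>) auto
  with assms show ?thesis
    by (simp add: tautology_def)
qed

lemma S4_frames_iff_valid:
  fixes F :: "('i, 'w) frame"
  assumes "is_frame F"
  shows "F \<in> S4_frames \<longleftrightarrow> (\<forall>\<phi>\<in>(S4_axioms :: ('i, 'p) fm set). valid_on F \<phi>)"
proof
  assume F: "F \<in> S4_frames"
  show "\<forall>\<phi>\<in>(S4_axioms :: ('i, 'p) fm set). valid_on F \<phi>"
  proof
    fix \<phi> :: "('i, 'p) fm"
    assume "\<phi> \<in> S4_axioms"
    with F show "valid_on F \<phi>"
      unfolding S4_axioms_def S4_frames_def valid_on_def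
      by (auto simp: sat_tautology) (meson refl_onD, meson transD)
  qed
next
  assume valid: "\<forall>\<phi>\<in>(S4_axioms :: ('i, 'p) fm set). valid_on F \<phi>"
  have sub: "acc F i \<subseteq> worlds F \<times> worlds F" for i
    using assms by (simp add: is_frame_def)
  have "refl_on (worlds F) (acc F i)" for i
  proof -
    have "valid_on F (K i (Atom undefined) \<^bold>\<rightarrow> (Atom undefined :: ('i, 'p) fm))"
      using valid by (auto simp: S4_axioms_def)
    then have *: "sat F (\<lambda>v _. (w, v) \<in> acc F i) w
        (K i (Atom undefined) \<^bold>\<rightarrow> (Atom undefined :: ('i, 'p) fm))" if "w \<in> worlds F" for w
      using that unfolding valid_on_def by blast
    show ?thesis
      using * sub by (auto simp: refl_on_def)
  qed
  moreover have "trans (acc F i)" for i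
  proof (rule transI)
    fix u v w
    assume uv: "(u, v) \<in> acc F i" and vw: "(v, w) \<in> acc F i"
    have "valid_on F (K i (Atom undefined) \<^bold>\<rightarrow> K i (K i (Atom undefined :: ('i, 'p) fm)))"
      using valid by (auto simp: S4_axioms_def)
    then have "sat F (\<lambda>x _. (u, x) \<in> acc F i) u
        (K i (Atom undefined) \<^bold>\<rightarrow> K i (K i (Atom undefined :: ('i, 'p) fm)))"
      using uv sub unfolding valid_on_def by blast
    with uv vw sub show "(u, w) \<in> acc F i"
      by auto
  qed
  ultimately show "F \<in> S4_frames"
    using assms by (simp add: S4_frames_def)
qed

lemma pure_S4_no_loeb_sentences:
  "\<not> (S4_axioms \<turnstile> K i ((\<psi> :: ('i, 'p) fm) \<^bold>\<leftrightarrow> (K i \<psi> \<^bold>\<rightarrow> \<^bold>\<bottom>)))"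
proof
  let ?F = "\<lparr>worlds = {()}, acc = \<lambda>_ :: 'i. {((), ())}\<rparr>"
  let ?V = "\<lambda>_ (_ :: 'p). True"
  have "is_frame ?F" "?F \<in> S4_frames"
    by (auto simp: is_frame_def S4_frames_def refl_on_def trans_def)
  then have ax: "\<forall>\<phi>\<in>(S4_axioms :: ('i, 'p) fm set). valid_on ?F \<phi>"
    by (rule S4_frames_iff_valid[THEN iffD1])
  have "sat ?F ?V () \<phi>" if "S4_axioms \<turnstile> \<phi>" for \<phi>
    using that
  proof induction
    case (axiom \<phi>)
    with ax show ?case
      by (simp add: valid_on_def)
  qed auto
  moreover assume "S4_axioms \<turnstile> K i (\<psi> \<^bold>\<leftrightarrow> (K i \<psi> \<^bold>\<rightarrow> \<^bold>\<bottom>))"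
  ultimately have "sat ?F ?V () (K i (\<psi> \<^bold>\<leftrightarrow> (K i \<psi> \<^bold>\<rightarrow> \<^bold>\<bottom>)))"
    by blast
  then show False
    by simp
qed

end

(* By Truth, a Loeb sentence \<psi> for \<phi> yields \<psi> \<leftrightarrow> (K \<psi> \<rightarrow> \<phi>) itself, and
   Curry's argument then proves \<phi>: Truth for \<psi> gives K \<psi> \<rightarrow> \<phi>, hence \<psi>, hence K \<psi> by
   necessitation, hence \<phi>. So every formula is derivable, in particular Loeb's Theorem,
   while the frames are reflexive by definition. *)

theory Submission
  imports Defs
begin

lemma S4_tautology:
  assumes "tautology \<phi>"
  shows "S4_axioms \<union> T \<turnstile> \<phi>"
  using assms by (auto intro: derives.axiom simp: S4_axioms_def)

lemma S4_truth: "S4_axioms \<union> T \<turnstile> K i \<phi> \<^bold>\<rightarrow> \<phi>"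
  by (auto intro: derives.axiom simp: S4_axioms_def)

lemma S4_curry:
  assumes loeb: "S4_axioms \<union> T \<turnstile> K i (\<psi> \<^bold>\<leftrightarrow> (K i \<psi> \<^bold>\<rightarrow> \<phi>))"
  shows "S4_axioms \<union> T \<turnstile> \<phi>"
proof -
  have fixpoint: "S4_axioms \<union> T \<turnstile> \<psi> \<^bold>\<leftrightarrow> (K i \<psi> \<^bold>\<rightarrow> \<phi>)"
    using S4_truth loeb by (rule modus_ponens)
  \<comment> \<open>Contraction: chaining Truth with the left-to-right half of the fixpoint gives K
    \<psi> \<rightarrow> (K \<psi> \<rightarrow> \<phi>), whose repeated premise collapses.
    \<open>K i \<psi>\<close> acts as a propositional atom.\<close>
  have "S4_axioms \<union> T \<turnstile>
      (\<psi> \<^bold>\<leftrightarrow> (K i \<psi> \<^bold>\<rightarrow> \<phi>)) \<^bold>\<rightarrow> (K i \<psi> \<^bold>\<rightarrow> \<psi>) \<^bold>\<rightarrow> (K i \<psi> \<^bold>\<rightarrow> \<phi>)"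
    by (rule S4_tautology) (auto simp: tautology_def)
  then have imp: "S4_axioms \<union> T \<turnstile> K i \<psi> \<^bold>\<rightarrow> \<phi>"
    by (rule modus_ponens[OF modus_ponens[OF _ fixpoint] S4_truth])
  have "S4_axioms \<union> T \<turnstile> (\<psi> \<^bold>\<leftrightarrow> (K i \<psi> \<^bold>\<rightarrow> \<phi>)) \<^bold>\<rightarrow> (K i \<psi> \<^bold>\<rightarrow> \<phi>) \<^bold>\<rightarrow> \<psi>"
    by (rule S4_tautology) (auto simp: tautology_def)
  then have "S4_axioms \<union> T \<turnstile> \<psi>"
    by (rule modus_ponens[OF modus_ponens[OF _ fixpoint] imp])
  \<comment> \<open>Sound to box: \<psi> is a theorem here, not a local assumption.\<close>
  then have "S4_axioms \<union> T \<turnstile> K i \<psi>"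
    by (rule necessitation)
  with imp show ?thesis
    by (rule modus_ponens)
qed

theorem theorem2:
  fixes T :: "('i, 'p) fm set" and i :: 'i
  assumes "expresses_loeb_sentences (axioms (S4 T :: ('i, 'p, 'w) modal_logic)) i"
  shows "crashes (S4 T :: ('i, 'p, 'w) modal_logic)"
proof -
  have "S4_axioms \<union> T \<turnstile> \<phi>" for \<phi>
  proof -
    obtain \<psi> where "S4_axioms \<union> T \<turnstile> K i (\<psi> \<^bold>\<leftrightarrow> (K i \<psi> \<^bold>\<rightarrow> \<phi>))"
      using assms by (auto simp: expresses_loeb_sentences_def S4_def)
    then show ?thesis
      by (rule S4_curry)
  qed
  then have "derives_loeb (S4_axioms \<union> T) i"
    by (simp add: derives_loeb_def)
  \<comment> \<open>The witness is the given \<open>i\<close>, with the reflexive disjunct of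
    \<open>crashes\<close>.\<close>
  then show ?thesis
    by (auto simp: crashes_def S4_def S4_frames_def)
qed

end
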